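(* Let $d\ge 2$. If two polynomial knots $\phi,\psi$ lie in the same path component of $\mathcal Q_d$, then $\phi$ and $\psi$ are topologically equivalent.
   Context: A polynomial knot is a map $\phi:\mathbb R\to\mathbb R^3$ with real polynomial components which is a smooth embedding ($\phi$ injective and $\phi'(t)\ne0$ for all $t$). For $d\ge2$, $\mathcal A_d$ is the set of polynomial maps $t\mapsto(f(t),g(t),h(t))$ with $\deg f\le d-2$, $\deg g\le d-1$, $\deg h\le d$, topologized via the bijection with $\mathbb R^{3d}$ sending $(f,g,h)$ to the vector $(a_0,\dots,a_{d-2},b_0,\dots,b_{d-1},c_0,\dots,c_d)$ of coefficients of $f=\sum a_it^i$, $g=\sum b_it^i$, $h=\sum c_it^i$. $\mathcal Q_d$ is the subspace of $\mathcal A_d$ consisting of polynomial knots $(f,g,h)$ with $\deg f=d-2$, $\deg g=d-1$, $\deg h=d$ exactly. A polynomial knot $\phi$ extends, via the inverse of stereographic projection $\mathbb R^3\to S^3\setminus\{N\}$ and sending $\infty\mapsto N$, to a unique continuous embedding (tame knot) $\tilde\phi:S^1\to S^3$. Two polynomial knots $\phi,\psi$ are topologically equivalent if $\tilde\phi$ and $\tilde\psi$ are ambient isotopic, i.e. there is a continuous $H:[0,1]\times S^3\to S^3$ with each $H(s,\cdot)$ a homeomorphism, $H(0,\cdot)=\mathrm{id}$ and $\tilde\psi=H(1,\cdot)\circ\tilde\phi$. *)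

theory Defs
  imports "HOL-Analysis.Analysis" "HOL-Computational_Algebra.Polynomial"
begin

type_synonym R3 = "real \<times> real \<times> real"
type_synonym R4 = "real \<times> real \<times> real \<times> real"

definition polymap :: "real poly \<Rightarrow> real poly \<Rightarrow> real poly \<Rightarrow> real \<Rightarrow> R3" where
  "polymap f g h t = (poly f t, poly g t, poly h t)"

definition poly_knot :: "real poly \<Rightarrow> real poly \<Rightarrow> real poly \<Rightarrow> bool" where
  "poly_knot f g h \<longleftrightarrow> inj (polymap f g h) \<and>
     (\<forall>t. (poly (pderiv f) t, poly (pderiv g) t, poly (pderiv h) t) \<noteq> (0, 0, 0))"

definition in_A :: "nat \<Rightarrow> real poly \<Rightarrow> real poly \<Rightarrow> real poly \<Rightarrow> bool" where
  "in_A d f g h \<longleftrightarrow> degree f \<le> d - 2 \<and> degree g \<le> d - 1 \<and> degree h \<le> d"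

definition in_Q :: "nat \<Rightarrow> real poly \<Rightarrow> real poly \<Rightarrow> real poly \<Rightarrow> bool" where
  "in_Q d f g h \<longleftrightarrow> in_A d f g h \<and>
     coeff f (d - 2) \<noteq> 0 \<and> coeff g (d - 1) \<noteq> 0 \<and> coeff h d \<noteq> 0 \<and> poly_knot f g h"

text \<open>Same path component of Q_d, with the topology of A_d given by the coefficient vector
  (equivalently: all coefficients depend continuously on the path parameter).\<close>
definition same_path_component_Q ::
  "nat \<Rightarrow> real poly \<times> real poly \<times> real poly \<Rightarrow> real poly \<times> real poly \<times> real poly \<Rightarrow> bool" where
  "same_path_component_Q d p q \<longleftrightarrow>
     (\<exists>F G H :: real \<Rightarrow> real poly.
        (\<forall>s\<in>{0..1}. in_Q d (F s) (G s) (H s)) \<and>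
        (\<forall>i. continuous_on {0..1} (\<lambda>s. coeff (F s) i)) \<and>
        (\<forall>i. continuous_on {0..1} (\<lambda>s. coeff (G s) i)) \<and>
        (\<forall>i. continuous_on {0..1} (\<lambda>s. coeff (H s) i)) \<and>
        (F 0, G 0, H 0) = p \<and> (F 1, G 1, H 1) = q)"

definition stereo_inv3 :: "R3 \<Rightarrow> R4" where
  "stereo_inv3 p = (case p of (x, y, z) \<Rightarrow>
     (let n = x\<^sup>2 + y\<^sup>2 + z\<^sup>2 in
       (2 * x / (n + 1), 2 * y / (n + 1), 2 * z / (n + 1), (n - 1) / (n + 1))))"

definition north4 :: R4 where "north4 = (0, 0, 0, 1)"

definition S3 :: "R4 set" where "S3 = sphere 0 1"

definition S1 :: "complex set" where "S1 = sphere 0 1"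

definition stereo1 :: "complex \<Rightarrow> real" where
  "stereo1 z = Re z / (1 - Im z)"

definition knot_ext :: "(real \<Rightarrow> R3) \<Rightarrow> complex \<Rightarrow> R4" where
  "knot_ext \<phi> z = (if z = \<i> then north4 else stereo_inv3 (\<phi> (stereo1 z)))"

definition ambient_isotopic :: "(complex \<Rightarrow> R4) \<Rightarrow> (complex \<Rightarrow> R4) \<Rightarrow> bool" where
  "ambient_isotopic k1 k2 \<longleftrightarrow>
     (\<exists>H :: real \<Rightarrow> R4 \<Rightarrow> R4.
        continuous_on ({0..1} \<times> S3) (\<lambda>(s, x). H s x) \<and>
        (\<forall>s\<in>{0..1}. \<exists>K. homeomorphism S3 S3 (H s) K) \<and>
        (\<forall>x\<in>S3. H 0 x = x) \<and>
        (\<forall>z\<in>S1. k2 z = H 1 (k1 z)))"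

definition top_equivalent :: "(real \<Rightarrow> R3) \<Rightarrow> (real \<Rightarrow> R3) \<Rightarrow> bool" where
  "top_equivalent \<phi> \<psi> \<longleftrightarrow> ambient_isotopic (knot_ext \<phi>) (knot_ext \<psi>)"

end

(* The leading coefficients force the divided differences of phi = (f, g, h) to dominate those of
   all monomials of degree at most d: one of d - 1, d is odd, and in odd degree the divided difference
   of the leading monomial is coercive. Hence every psi in A_d close to phi has a difference
   psi - phi which, as a function on the image of phi, is Lipschitz with a small constant. A McShane
   extension u of it to R^3 makes x + s u(x) an isotopy of homeomorphisms of R^3 carrying phi to psi,
   and it extends to S^3 by fixing the north pole. So topological equivalence is an open equivalence
   relation along a path in Q_d, and [0,1] is connected. *)
theory Submission
  imports Defs
begin


section \<open>Lipschitz extension\<close>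

text \<open>McShane's construction: \<open>u\<close> is the lower envelope of the cones
  \<open>v i + L * dist (p i) x\<close>, each \<open>L\<close>-Lipschitz in \<open>x\<close>.
  Indexing the data by a family lets them be prescribed through the parameter of a curve.\<close>

lemma lipschitz_extension_real:
  fixes p :: "'i \<Rightarrow> 'a::metric_space" and v :: "'i \<Rightarrow> real"
  assumes L: "0 \<le> L" and v: "\<And>i j. \<bar>v i - v j\<bar> \<le> L * dist (p i) (p j)"
  shows "\<exists>u. (\<forall>i. u (p i) = v i) \<and> (\<forall>x y. \<bar>u x - u y\<bar> \<le> L * dist x y)"
proof -
  define u where "u x = (INF i. v i + L * dist (p i) x)" for x
  \<comment> \<open>A cone opening downwards from one data point stays below every upward cone. This
    makes the infimum finite and pins its value at the data points.\<close>
  have low: "v j - L * dist (p j) x \<le> v i + L * dist (p i) x" for i j x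
  proof -
    have "v j - v i \<le> L * dist (p i) (p j)"
      using v[of i j] by linarith
    also have "\<dots> \<le> L * (dist (p i) x + dist (p j) x)"
      using L dist_triangle2 by (intro mult_left_mono)
    finally show ?thesis
      by (simp add: algebra_simps)
  qed
  have bdd: "bdd_below (range (\<lambda>i. v i + L * dist (p i) x))" for x
    using low by (intro bdd_belowI2)
  have "u (p i) = v i" for i
  proof (rule antisym)
    show "u (p i) \<le> v i"
      unfolding u_def using cINF_lower[OF bdd, of i "p i"] by simp
    show "v i \<le> u (p i)"
      unfolding u_def using low[of i "p i"] by (intro cINF_greatest) auto
  qed
  moreover have le: "u x - u y \<le> L * dist x y" for x y
  proof -
    have "u x - L * dist x y \<le> v i + L * dist (p i) y" for i
    proof -
      have "u x \<le> v i + L * dist (p i) x"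
        unfolding u_def by (rule cINF_lower[OF bdd UNIV_I])
      moreover have "L * dist (p i) x \<le> L * (dist (p i) y + dist x y)"
        using L dist_triangle2 by (intro mult_left_mono)
      ultimately show ?thesis
        by (simp add: algebra_simps)
    qed
    then have "u x - L * dist x y \<le> u y"
      unfolding u_def[of y] by (intro cINF_greatest) auto
    then show ?thesis
      by simp
  qed
  have "\<bar>u x - u y\<bar> \<le> L * dist x y" for x y
    using le[of x y] le[of y x] by (auto simp: abs_le_iff dist_commute)
  ultimately show ?thesis
    by blast
qed

section \<open>Norms of triples and stereographic projection\<close>

lemma norm_triple: "norm (x, y, z) = sqrt (x\<^sup>2 + y\<^sup>2 + z\<^sup>2)" for x y z :: real
  by (simp add: norm_Pair)

lemma norm_triple_le: "norm (x, y, z) \<le> \<bar>x\<bar> + \<bar>y\<bar> + \<bar>z\<bar>" for x y z :: real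
  by (smt (verit) norm_Pair_le real_norm_def)

lemma abs_le_norm_triple:
  fixes x y z :: real
  shows "\<bar>x\<bar> \<le> norm (x, y, z)" "\<bar>y\<bar> \<le> norm (x, y, z)" "\<bar>z\<bar> \<le> norm (x, y, z)"
  by (auto simp: norm_triple intro!: real_le_rsqrt)

text \<open>Total by division by zero at \<open>north4\<close>, which is why the inverse law and
  continuity below exclude that point.\<close>

definition stereo3 :: "R4 \<Rightarrow> R3" where
  "stereo3 x = (case x of (a, b, c, w) \<Rightarrow> (a / (1 - w), b / (1 - w), c / (1 - w)))"

lemma mem_S3: "(a, b, c, w) \<in> S3 \<longleftrightarrow> a\<^sup>2 + b\<^sup>2 + c\<^sup>2 + w\<^sup>2 = 1"
  by (simp add: S3_def norm_Pair add.assoc)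

lemma compact_S3: "compact S3"
  by (simp add: S3_def)

lemma north4_in_S3: "north4 \<in> S3"
  by (simp add: north4_def mem_S3)

lemma S3_height_neq_1:
  assumes "(a, b, c, w) \<in> S3" "(a, b, c, w) \<noteq> north4"
  shows "w \<noteq> 1"
proof
  assume "w = 1"
  then have "a\<^sup>2 + b\<^sup>2 + c\<^sup>2 = 0"
    using assms(1) by (simp add: mem_S3)
  then have "a = 0 \<and> b = 0 \<and> c = 0"
    by (smt (verit) zero_le_power2 power2_eq_iff_nonneg zero_eq_power2)
  then show False
    using assms(2) \<open>w = 1\<close> by (simp add: north4_def)
qed

lemma stereo_inv3_altdef:
  "stereo_inv3 p = (2 * fst p / ((norm p)\<^sup>2 + 1), 2 * fst (snd p) / ((norm p)\<^sup>2 + 1),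
     2 * snd (snd p) / ((norm p)\<^sup>2 + 1), ((norm p)\<^sup>2 - 1) / ((norm p)\<^sup>2 + 1))"
  by (cases p) (simp add: stereo_inv3_def norm_triple Let_def)

lemma norm_sq_plus_1_neq_0: "(norm x)\<^sup>2 + 1 \<noteq> 0"
  by (smt (verit) zero_le_power2)

lemma continuous_on_stereo_inv3: "continuous_on A stereo_inv3"
  unfolding stereo_inv3_altdef[abs_def]
  by (intro continuous_intros) (auto simp: norm_sq_plus_1_neq_0)

lemma stereo_inv3_in_S3: "stereo_inv3 p \<in> S3"
proof (cases p)
  case (fields x y z)
  define n where "n = x\<^sup>2 + y\<^sup>2 + z\<^sup>2"
  have "n + 1 > 0"
    unfolding n_def by (smt (verit) zero_le_power2)
  have "(2 * x)\<^sup>2 + (2 * y)\<^sup>2 + (2 * z)\<^sup>2 + (n - 1)\<^sup>2 = (n + 1)\<^sup>2"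
    unfolding n_def by (simp add: power2_eq_square algebra_simps)
  then have "(2 * x / (n + 1))\<^sup>2 + (2 * y / (n + 1))\<^sup>2 + (2 * z / (n + 1))\<^sup>2 + ((n - 1) / (n + 1))\<^sup>2 = 1"
    using \<open>n + 1 > 0\<close> by (simp add: power_divide flip: add_divide_distrib)
  then show ?thesis
    by (simp add: fields stereo_inv3_def mem_S3 Let_def n_def)
qed

lemma stereo_inv3_neq_north4: "stereo_inv3 p \<noteq> north4"
  by (simp add: stereo_inv3_altdef north4_def norm_sq_plus_1_neq_0)

lemma stereo3_stereo_inv3 [simp]: "stereo3 (stereo_inv3 p) = p"
proof (cases p)
  case (fields x y z)
  define n where "n = x\<^sup>2 + y\<^sup>2 + z\<^sup>2"
  have "n + 1 > 0"
    unfolding n_def by (smt (verit) zero_le_power2)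
  then have "1 - (n - 1) / (n + 1) = 2 / (n + 1)"
    by (simp add: field_simps)
  moreover have "2 * v / (n + 1) / (2 / (n + 1)) = v" for v
    using \<open>n + 1 > 0\<close> by (simp add: field_simps)
  ultimately show ?thesis
    by (simp only: fields stereo_inv3_def stereo3_def Let_def prod.case flip: n_def)
qed

lemma stereo_inv3_stereo3:
  assumes "x \<in> S3" "x \<noteq> north4"
  shows "stereo_inv3 (stereo3 x) = x"
proof (cases x)
  case (fields a b c w)
  have w: "1 - w \<noteq> 0"
    using S3_height_neq_1 assms fields by force
  have "a\<^sup>2 + b\<^sup>2 + c\<^sup>2 = (1 - w) * (1 + w)"
    using assms by (simp add: fields mem_S3 power2_eq_square algebra_simps)
  then have "(a / (1 - w))\<^sup>2 + (b / (1 - w))\<^sup>2 + (c / (1 - w))\<^sup>2 = (1 + w) / (1 - w)"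
    using w by (simp add: power_divide power2_eq_square flip: add_divide_distrib)
  moreover have "(1 + w) / (1 - w) + 1 = 2 / (1 - w)" "(1 + w) / (1 - w) - 1 = 2 * w / (1 - w)"
    using w by (simp_all add: field_simps)
  moreover have "2 * (v / (1 - w)) / (2 / (1 - w)) = v" "2 * v / (1 - w) / (2 / (1 - w)) = v" for v
    using w by (simp_all add: field_simps)
  ultimately show ?thesis
    by (simp only: fields stereo_inv3_def stereo3_def Let_def prod.case)
qed

lemma continuous_on_stereo3: "continuous_on (S3 - {north4}) stereo3"
proof -
  have "snd (snd (snd x)) \<noteq> 1" if "x \<in> S3 - {north4}" for x
    using that S3_height_neq_1 by (cases x) auto
  then have "continuous_on (S3 - {north4}) (\<lambda>x. (fst x / (1 - snd (snd (snd x))),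
      fst (snd x) / (1 - snd (snd (snd x))), fst (snd (snd x)) / (1 - snd (snd (snd x)))))"
    by (intro continuous_intros) auto
  then show ?thesis
    by (simp add: stereo3_def[abs_def] case_prod_unfold)
qed

text \<open>Converts growth estimates on \<real>^3 into estimates near the pole: the chordal
  distance decays like \<open>2 / norm p\<close>.\<close>

lemma dist_stereo_inv3_north4: "dist (stereo_inv3 p) north4 = 2 / sqrt ((norm p)\<^sup>2 + 1)"
proof (cases p)
  case (fields x y z)
  define n where "n = x\<^sup>2 + y\<^sup>2 + z\<^sup>2"
  have n: "n + 1 > 0"
    unfolding n_def by (smt (verit) zero_le_power2)
  have "(n - 1) / (n + 1) - 1 = - 2 / (n + 1)"
    using n by (simp add: field_simps)
  then have "dist (stereo_inv3 p) north4 =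
      sqrt ((2 * x / (n + 1))\<^sup>2 + (2 * y / (n + 1))\<^sup>2 + (2 * z / (n + 1))\<^sup>2 + (- 2 / (n + 1))\<^sup>2)"
    by (simp add: fields stereo_inv3_def north4_def Let_def dist_norm norm_Pair add.assoc flip: n_def)
       (simp add: n_def add.assoc power_divide)
  also have "(2 * x / (n + 1))\<^sup>2 + (2 * y / (n + 1))\<^sup>2 + (2 * z / (n + 1))\<^sup>2 + (- 2 / (n + 1))\<^sup>2
      = 4 * (n + 1) / (n + 1)\<^sup>2"
    by (simp add: n_def power_divide flip: add_divide_distrib)
  also have "\<dots> = 4 / (n + 1)"
    using n unfolding power2_eq_square by (metis less_irrefl mult_divide_mult_cancel_right)
  finally show ?thesis
    by (simp add: fields norm_triple n_def real_sqrt_divide)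
qed

lemma knot_ext_in_S3: "knot_ext \<phi> z \<in> S3"
  by (simp add: knot_ext_def north4_in_S3 stereo_inv3_in_S3)

section \<open>From a Lipschitz perturbation to an ambient isotopy\<close>

text \<open>The isotopy on \<open>\<real>\<^sup>3\<close> is \<open>x \<mapsto> x + s u(x)\<close>: a perturbation of the identity by a
  contraction is bijective, and it is proper uniformly in \<open>s\<close>, so that it extends to the point
  at infinity.\<close>
lemma top_equivalent_lipschitz_perturbation:
  fixes \<phi> \<psi> :: "real \<Rightarrow> R3" and u :: "R3 \<Rightarrow> R3"
  assumes L: "0 \<le> L" "L < 1"
    and u: "\<And>x y. dist (u x) (u y) \<le> L * dist x y"
    and \<psi>: "\<And>t. \<psi> t = \<phi> t + u (\<phi> t)"
  shows "top_equivalent \<phi> \<psi>"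
proof -
  define F where "F s x = x + s *\<^sub>R u x" for s x
  have contr: "dist (s *\<^sub>R u x) (s *\<^sub>R u y) \<le> L * dist x y" if "s \<in> {0..1}" for s x y
  proof -
    have "dist (s *\<^sub>R u x) (s *\<^sub>R u y) = s * dist (u x) (u y)"
      using that by (simp add: dist_norm flip: scaleR_right_diff_distrib)
    also have "\<dots> \<le> 1 * dist (u x) (u y)"
      using that by (intro mult_right_mono) auto
    finally show ?thesis
      using u[of x y] by simp
  qed
  \<comment> \<open>Equal images would make the distance of \<open>x\<close> and \<open>y\<close> at
    most \<open>L\<close> times itself.\<close>
  have F_inj: "x = y" if "s \<in> {0..1}" "F s x = F s y" for s x y
  proof (rule ccontr)
    assume "x \<noteq> y"
    have "x - y = s *\<^sub>R u y - s *\<^sub>R u x"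
      using that(2) by (simp add: F_def algebra_simps)
    then have "dist x y \<le> L * dist x y"
      using contr[OF that(1), of y x] by (simp add: dist_norm norm_minus_commute)
    then show False
      using \<open>x \<noteq> y\<close> L by simp
  qed
  \<comment> \<open>A preimage of \<open>y\<close> is a fixed point of the contraction sending
    \<open>x\<close> to \<open>y - s *\<^sub>R u x\<close>.\<close>
  have F_surj: "\<exists>x. F s x = y" if "s \<in> {0..1}" for s y
  proof -
    have "\<exists>!x. y - s *\<^sub>R u x = x"
      using L contr[OF that] by (intro banach_fix_type[of L]) (auto simp: dist_norm norm_minus_commute)
    then obtain x where "y - s *\<^sub>R u x = x"
      by blast
    then have "F s x = y"
      unfolding F_def by (metis diff_add_cancel)
    then show ?thesis
      by blast
  qed
  have "L-lipschitz_on UNIV u"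
    using u L by (intro lipschitz_onI)
  then have cont_u: "continuous_on UNIV u"
    by (rule lipschitz_on_continuous_on)
  have cont_F: "continuous_on A (\<lambda>(s, x). F s x)" for A
    unfolding F_def case_prod_unfold
    by (intro continuous_intros continuous_on_compose2[OF cont_u]) auto
  define B where "B = norm (u 0)"
  \<comment> \<open>Linear growth with constants independent of \<open>s\<close>, hence properness
    uniformly in time.\<close>
  have F_lower: "(1 - L) * norm x \<le> norm (F s x) + B" if "s \<in> {0..1}" for s x
  proof -
    have "norm x \<le> norm (F s x) + norm (s *\<^sub>R u x)"
      unfolding F_def by (metis add_diff_cancel norm_triangle_ineq4)
    moreover have "norm (s *\<^sub>R u x) \<le> 1 * norm (u x)"
      using that unfolding norm_scaleR by (intro mult_right_mono) auto
    moreover have "norm (u x) \<le> L * norm x + B"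
      using u[of x 0] norm_triangle_sub[of "u x" "u 0"] by (simp add: dist_norm B_def)
    ultimately show ?thesis
      by (simp add: algebra_simps)
  qed
  define H where "H s x = (if x = north4 then north4 else stereo_inv3 (F s (stereo3 x)))" for s x
  \<comment> \<open>With \<open>n = norm (F s p)\<close>, squaring \<open>F_lower\<close> and
    bounding \<open>(n + B)\<^sup>2\<close> by \<open>2 * (1 + B\<^sup>2) * (n\<^sup>2 + 1)\<close>
    gives \<open>(norm p)\<^sup>2 \<le> q * (n\<^sup>2 + 1)\<close>. Adding 1 turns \<open>q\<close>
    into \<open>q + 1\<close>, whose root \<open>M\<close> bounds the stretching of distances to the
    pole.\<close>
  define q where "q = 2 * (1 + B\<^sup>2) / (1 - L)\<^sup>2"
  have "q \<ge> 0"
    by (simp add: q_def)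
  define M where "M = sqrt (q + 1)"
  have M0: "M > 0" and M_sq: "M\<^sup>2 = q + 1"
    using \<open>q \<ge> 0\<close> by (simp_all add: M_def)
  have near: "dist (H s x) north4 \<le> M * dist x north4" if s: "s \<in> {0..1}" and x: "x \<in> S3" for s x
  proof (cases "x = north4")
    case True
    then show ?thesis by (simp add: H_def)
  next
    case False
    define p where "p = stereo3 x"
    define n where "n = norm (F s p)"
    have x_eq: "x = stereo_inv3 p"
      using False x by (simp add: p_def stereo_inv3_stereo3)
    have Hx: "H s x = stereo_inv3 (F s p)"
      using False by (simp add: H_def p_def)
    have "((1 - L) * norm p)\<^sup>2 \<le> (n + B)\<^sup>2"
      using F_lower[OF s, of p] L by (intro power_mono) (auto simp: n_def)
    also have "\<dots> \<le> 2 * (n\<^sup>2 + B\<^sup>2)"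
      using zero_le_power2[of "n - B"] by (simp add: power2_eq_square algebra_simps)
    also have "\<dots> \<le> 2 * (1 + B\<^sup>2) * (n\<^sup>2 + 1)"
      by (simp add: algebra_simps)
    finally have "(norm p)\<^sup>2 \<le> q * (n\<^sup>2 + 1)"
      using L by (simp add: q_def pos_le_divide_eq power_mult_distrib mult.commute)
    then have "(norm p)\<^sup>2 + 1 \<le> M\<^sup>2 * (n\<^sup>2 + 1)"
      unfolding M_sq distrib_right[of q] by (rule add_mono) simp
    then have "sqrt ((norm p)\<^sup>2 + 1) \<le> sqrt (M\<^sup>2 * (n\<^sup>2 + 1))"
      by simp
    also have "\<dots> = M * sqrt (n\<^sup>2 + 1)"
      using M0 by (simp add: real_sqrt_mult)
    finally have "sqrt ((norm p)\<^sup>2 + 1) \<le> M * sqrt (n\<^sup>2 + 1)" .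
    moreover have "sqrt ((norm p)\<^sup>2 + 1) > 0" "sqrt (n\<^sup>2 + 1) > 0"
      by (simp_all add: add_nonneg_pos)
    ultimately have "2 / sqrt (n\<^sup>2 + 1) \<le> M * (2 / sqrt ((norm p)\<^sup>2 + 1))"
      by (simp add: field_simps)
    then show ?thesis
      unfolding Hx unfolding x_eq by (simp add: dist_stereo_inv3_north4 n_def)
  qed
  have "continuous_on ({0..1} \<times> S3) (\<lambda>(s, x). H s x)"
    unfolding continuous_on_def
  proof (intro ballI)
    fix z :: "real \<times> R4"
    assume z: "z \<in> {0..1} \<times> S3"
    obtain s x where sx: "z = (s, x)" "s \<in> {0..1}" "x \<in> S3"
      using z by auto
    show "((\<lambda>(s, x). H s x) \<longlongrightarrow> (case z of (s, x) \<Rightarrow> H s x)) (at z within {0..1} \<times> S3)"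
    proof (cases "x = north4")
      case False
      have "continuous_on ({0..1} \<times> (S3 - {north4})) (\<lambda>(s, x). stereo_inv3 (F s (stereo3 x)))"
        unfolding case_prod_unfold
        by (intro continuous_on_compose2[OF continuous_on_stereo_inv3[of UNIV]]
              continuous_on_compose2[OF cont_F[of UNIV, unfolded case_prod_unfold],
                where f = "\<lambda>z. (fst z, stereo3 (snd z))", simplified]
              continuous_intros continuous_on_compose2[OF continuous_on_stereo3]) auto
      then have "continuous_on ({0..1} \<times> (S3 - {north4})) (\<lambda>(s, x). H s x)"
        by (rule continuous_on_eq) (auto simp: H_def split: if_splits)
      then have "((\<lambda>(s, x). H s x) \<longlongrightarrow> (case z of (s, x) \<Rightarrow> H s x))
          (at z within {0..1} \<times> (S3 - {north4}))"
        unfolding continuous_on_def using sx False by blast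
      moreover have "at z within {0..1} \<times> (S3 - {north4}) = at z within {0..1} \<times> S3"
        using sx False
        by (intro at_within_nhd[of z "UNIV \<times> (- {north4})"] open_Times) auto
      ultimately show ?thesis
        by simp
    next
      case True
      have "((\<lambda>z. M * dist (snd z) north4) \<longlongrightarrow> M * dist (snd z) north4) (at z within {0..1} \<times> S3)"
        by (intro tendsto_intros)
      then have lim: "((\<lambda>z. M * dist (snd z) north4) \<longlongrightarrow> 0) (at z within {0..1} \<times> S3)"
        using True sx by simp
      have ev: "\<forall>\<^sub>F z in at z within {0..1} \<times> S3.
          norm (dist (case z of (s, x) \<Rightarrow> H s x) north4) \<le> M * dist (snd z) north4"
        unfolding eventually_at_filter using near by (intro always_eventually) auto
      have "((\<lambda>(s, x). H s x) \<longlongrightarrow> north4) (at z within {0..1} \<times> S3)"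
        by (rule iffD2[OF tendsto_dist_iff Lim_null_comparison[OF ev lim]])
      then show ?thesis
        using True sx by (simp add: H_def)
    qed
  qed
  note cont_H = this
  have "\<exists>K. homeomorphism S3 S3 (H s) K" if s: "s \<in> {0..1}" for s
  \<comment> \<open>By compactness of the sphere, the inverse of a continuous bijection is
    automatically continuous.\<close>
  proof (rule homeomorphism_compact[OF compact_S3])
    have "continuous_on S3 (\<lambda>x. case (s, x) of (s, x) \<Rightarrow> H s x)"
      using s by (intro continuous_on_compose2[OF cont_H] continuous_intros) auto
    then show "continuous_on S3 (H s)"
      by simp
    show "inj_on (H s) S3"
    proof (rule inj_onI)
      fix x y
      assume xy: "x \<in> S3" "y \<in> S3" "H s x = H s y"
      show "x = y"
      proof (cases "x = north4 \<or> y = north4")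
        case True
        then show ?thesis
          using xy stereo_inv3_neq_north4 by (metis H_def)
      next
        case False
        then have "F s (stereo3 x) = F s (stereo3 y)"
          using xy(3) unfolding H_def by (metis stereo3_stereo_inv3)
        then show ?thesis
          using F_inj[OF s] False xy stereo_inv3_stereo3 by metis
      qed
    qed
    have "H s x \<in> S3" for x
      by (simp add: H_def north4_in_S3 stereo_inv3_in_S3)
    moreover have "y \<in> H s ` S3" if "y \<in> S3" for y
    proof (cases "y = north4")
      case True
      then show ?thesis
        using north4_in_S3 by (intro image_eqI[of _ _ north4]) (auto simp: H_def)
    next
      case False
      obtain p where "F s p = stereo3 y"
        using F_surj[OF s] by blast
      then have "H s (stereo_inv3 p) = y"
        using False that by (simp add: H_def stereo_inv3_neq_north4 stereo_inv3_stereo3)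
      then show ?thesis
        using stereo_inv3_in_S3 by blast
    qed
    ultimately show "H s ` S3 = S3"
      by blast
  qed
  moreover have "\<forall>x\<in>S3. H 0 x = x"
    by (simp add: H_def F_def stereo_inv3_stereo3)
  moreover have "\<forall>z\<in>S1. knot_ext \<psi> z = H 1 (knot_ext \<phi> z)"
    by (simp add: knot_ext_def H_def F_def stereo_inv3_neq_north4 \<psi>)
  ultimately show ?thesis
    unfolding top_equivalent_def ambient_isotopic_def using cont_H by blast
qed

section \<open>Ambient isotopy as an equivalence relation\<close>

text \<open>Run the isotopy backwards after undoing its end: \<open>H (1 - s)\<close> composed with
  the inverse \<open>K\<close> of \<open>H 1\<close>. Only one fixed inverse occurs, so joint
  continuity is inherited from \<open>H\<close>.\<close>

lemma ambient_isotopic_sym: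
  assumes "ambient_isotopic k1 k2" and k1: "\<And>z. z \<in> S1 \<Longrightarrow> k1 z \<in> S3"
  shows "ambient_isotopic k2 k1"
proof -
  from assms(1) obtain H :: "real \<Rightarrow> R4 \<Rightarrow> R4" where
    cont: "continuous_on ({0..1} \<times> S3) (\<lambda>(s, x). H s x)"
    and homeo: "\<And>s. s \<in> {0..1} \<Longrightarrow> \<exists>K. homeomorphism S3 S3 (H s) K"
    and H0: "\<And>x. x \<in> S3 \<Longrightarrow> H 0 x = x"
    and H1: "\<And>z. z \<in> S1 \<Longrightarrow> k2 z = H 1 (k1 z)"
    unfolding ambient_isotopic_def by blast
  obtain K where K: "homeomorphism S3 S3 (H 1) K"
    using homeo[of 1] by auto
  define G where "G s x = H (1 - s) (K x)" for s x
  have "continuous_on ({0..1} \<times> S3) (\<lambda>z. case (1 - fst z, K (snd z)) of (s, x) \<Rightarrow> H s x)"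
    using homeomorphism_cont2[OF K] homeomorphism_image2[OF K]
    by (intro continuous_on_compose2[OF cont] continuous_intros
        continuous_on_compose2[OF homeomorphism_cont2[OF K]]) auto
  then have "continuous_on ({0..1} \<times> S3) (\<lambda>(s, x). G s x)"
    by (simp add: G_def case_prod_unfold)
  moreover have "\<exists>K'. homeomorphism S3 S3 (G s) K'" if "s \<in> {0..1}" for s
  proof -
    obtain K' where "homeomorphism S3 S3 (H (1 - s)) K'"
      using homeo[of "1 - s"] \<open>s \<in> {0..1}\<close> by auto
    from homeomorphism_compose[OF homeomorphism_symD[OF K] this] show ?thesis
      by (auto simp: G_def[abs_def] o_def)
  qed
  moreover have "\<forall>x\<in>S3. G 0 x = x"
    using homeomorphism_apply2[OF K] by (simp add: G_def)
  moreover have "\<forall>z\<in>S1. k1 z = G 1 (k2 z)"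
    using homeomorphism_apply1[OF K] H0 H1 k1 by (simp add: G_def)
  ultimately show ?thesis
    unfolding ambient_isotopic_def by blast
qed

text \<open>Concatenation at double speed, the second isotopy being applied after the final map
  \<open>H 1\<close> of the first.\<close>

lemma ambient_isotopic_trans:
  assumes "ambient_isotopic k1 k2" "ambient_isotopic k2 k3"
  shows "ambient_isotopic k1 k3"
proof -
  from assms(1) obtain H :: "real \<Rightarrow> R4 \<Rightarrow> R4" where
    H: "continuous_on ({0..1} \<times> S3) (\<lambda>(s, x). H s x)"
      "\<And>s. s \<in> {0..1} \<Longrightarrow> \<exists>K. homeomorphism S3 S3 (H s) K"
      "\<And>x. x \<in> S3 \<Longrightarrow> H 0 x = x" "\<And>z. z \<in> S1 \<Longrightarrow> k2 z = H 1 (k1 z)"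
    unfolding ambient_isotopic_def by blast
  from assms(2) obtain H' :: "real \<Rightarrow> R4 \<Rightarrow> R4" where
    H': "continuous_on ({0..1} \<times> S3) (\<lambda>(s, x). H' s x)"
      "\<And>s. s \<in> {0..1} \<Longrightarrow> \<exists>K. homeomorphism S3 S3 (H' s) K"
      "\<And>x. x \<in> S3 \<Longrightarrow> H' 0 x = x" "\<And>z. z \<in> S1 \<Longrightarrow> k3 z = H' 1 (k2 z)"
    unfolding ambient_isotopic_def by blast
  obtain K1 where K1: "homeomorphism S3 S3 (H 1) K1"
    using H(2)[of 1] by auto
  define G where "G s x = (if s \<le> 1/2 then H (2 * s) x else H' (2 * s - 1) (H 1 x))" for s x
  have im: "H 1 x \<in> S3" if "x \<in> S3" for x
    using homeomorphism_image1[OF K1] that by blast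
  have "continuous_on ({0..1/2} \<times> S3) (\<lambda>z. case (2 * fst z, snd z) of (s, x) \<Rightarrow> H s x)"
    by (intro continuous_on_compose2[OF H(1)] continuous_intros) auto
  then have c1: "continuous_on ({0..1/2} \<times> S3) (\<lambda>z. H (2 * fst z) (snd z))"
    by simp
  have "continuous_on ({1/2..1} \<times> S3) (\<lambda>z. case (2 * fst z - 1, H 1 (snd z)) of (s, x) \<Rightarrow> H' s x)"
    by (intro continuous_on_compose2[OF H'(1)] continuous_intros
        continuous_on_compose2[OF homeomorphism_cont1[OF K1]]) (auto simp: im)
  then have c2: "continuous_on ({1/2..1} \<times> S3) (\<lambda>z. H' (2 * fst z - 1) (H 1 (snd z)))"
    by simp
  have un: "{0..1::real} \<times> S3 = {0..1/2} \<times> S3 \<union> {1/2..1} \<times> S3"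
    by auto
  \<comment> \<open>At time 1/2 both branches are \<open>H 1 x\<close>, because \<open>H' 0\<close>
    is the identity on \<open>S3\<close>.\<close>
  have "H (2 * s) x = H' (2 * s - 1) (H 1 x)" if "s * 2 = 1" "x \<in> S3" for s x
  proof -
    have "2 * s = 1"
      using that by simp
    then show ?thesis
      using that by (simp only: diff_self H'(3) im)
  qed
  moreover have "closed S3"
    by (simp add: compact_S3 compact_imp_closed)
  ultimately have "continuous_on ({0..1} \<times> S3)
      (\<lambda>z. if fst z \<le> 1/2 then H (2 * fst z) (snd z) else H' (2 * fst z - 1) (H 1 (snd z)))"
    unfolding un by (intro continuous_on_cases c1 c2 closed_Times) auto
  then have "continuous_on ({0..1} \<times> S3) (\<lambda>(s, x). G s x)"
    by (simp add: G_def case_prod_unfold)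
  moreover have "\<exists>K. homeomorphism S3 S3 (G s) K" if s: "s \<in> {0..1}" for s
  proof (cases "s \<le> 1/2")
    case True
    then show ?thesis
      using H(2)[of "2 * s"] s by (auto simp: G_def[abs_def])
  next
    case False
    then obtain K where "homeomorphism S3 S3 (H' (2 * s - 1)) K"
      using H'(2)[of "2 * s - 1"] s by auto
    from homeomorphism_compose[OF K1 this] show ?thesis
      using False by (auto simp: G_def[abs_def] o_def)
  qed
  moreover have "\<forall>x\<in>S3. G 0 x = x"
    by (simp add: G_def H(3))
  moreover have "\<forall>z\<in>S1. k3 z = G 1 (k1 z)"
    by (simp add: G_def H(4) H'(4))
  ultimately show ?thesis
    unfolding ambient_isotopic_def by blast
qed

section \<open>Divided differences of powers and polynomials\<close>

text \<open>\<open>power_dd k t s\<close> is the divided difference \<open>(t\<^sup>k - s\<^sup>k) / (t - s)\<close>, also on the diagonal.\<close>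
primrec power_dd :: "nat \<Rightarrow> 'a::comm_ring_1 \<Rightarrow> 'a \<Rightarrow> 'a" where
  "power_dd 0 t s = 0"
| "power_dd (Suc k) t s = t ^ k + s * power_dd k t s"

lemma diff_power_eq_dd: "t ^ k - s ^ k = (t - s) * power_dd k t s"
proof (induction k)
  case (Suc k)
  have "t ^ Suc k - s ^ Suc k = (t - s) * t ^ k + s * (t ^ k - s ^ k)"
    by (simp add: algebra_simps)
  also have "\<dots> = (t - s) * power_dd (Suc k) t s"
    unfolding Suc by (simp add: algebra_simps)
  finally show ?case .
qed simp

text \<open>The recursion with \<open>t\<close> and \<open>s\<close> exchanged; adding it to the
  defining one symmetrizes \<open>power_dd\<close>.\<close>

lemma power_dd_Suc': "power_dd (Suc k) t s = s ^ k + t * power_dd k t s"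
proof -
  have "t ^ k - s ^ k = (t - s) * power_dd k t s"
    by (rule diff_power_eq_dd)
  then show ?thesis
    by (simp add: algebra_simps)
qed

lemma power_dd_diag: "power_dd k t t = of_nat k * t ^ (k - 1)"
proof (induction k)
  case (Suc k)
  then show ?case by (cases k) (auto simp: algebra_simps)
qed simp

lemma continuous_on_power_dd [continuous_intros]:
  fixes f g :: "'a::topological_space \<Rightarrow> real"
  assumes "continuous_on A f" "continuous_on A g"
  shows "continuous_on A (\<lambda>x. power_dd k (f x) (g x))"
  by (induction k) (auto intro!: continuous_intros assms)

text \<open>\<open>power_dd k\<close> is a sum of \<open>k\<close> monomials of degree
  \<open>k - 1\<close>; for \<open>k = 0\<close> both sides vanish.\<close>

lemma abs_power_dd_le:
  fixes t s :: real
  assumes "\<bar>t\<bar> \<le> r" "\<bar>s\<bar> \<le> r"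
  shows "\<bar>power_dd k t s\<bar> \<le> k * r ^ (k - 1)"
proof (induction k)
  case (Suc k)
  have "0 \<le> r"
    using assms by linarith
  have "\<bar>power_dd (Suc k) t s\<bar> \<le> \<bar>t\<bar> ^ k + \<bar>s\<bar> * \<bar>power_dd k t s\<bar>"
    using abs_triangle_ineq[of "t ^ k" "s * power_dd k t s"] by (simp add: abs_mult power_abs)
  also have "\<dots> \<le> r ^ k + r * (k * r ^ (k - 1))"
    using assms Suc \<open>0 \<le> r\<close> by (intro add_mono power_mono mult_mono) auto
  also have "\<dots> = Suc k * r ^ (Suc k - 1)"
    by (cases k) (auto simp: algebra_simps)
  finally show ?case .
qed simp

text \<open>The product equals \<open>(t + s)\<^sup>2\<close> times the divided difference of the
  \<open>m\<close>-th power at the squares of \<open>t\<close> and \<open>s\<close>, which has only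
  nonnegative terms. The induction builds up this sum.\<close>

lemma sum_times_power_dd_even_nonneg:
  fixes t s :: real
  shows "0 \<le> (t + s) * power_dd (2 * m) t s"
proof (induction m)
  case (Suc m)
  have "power_dd (2 * Suc m) t s = t * t ^ (2 * m) + s * (t ^ (2 * m) + s * power_dd (2 * m) t s)"
    by simp
  then have "(t + s) * power_dd (2 * Suc m) t s
      = (t + s)\<^sup>2 * t ^ (2 * m) + s\<^sup>2 * ((t + s) * power_dd (2 * m) t s)"
    by (simp only: power2_eq_square distrib_left distrib_right mult_ac add_ac)
  also have "\<dots> \<ge> 0"
    using mult_nonneg_nonneg[OF zero_le_power2[of s] Suc] by simp
  finally show ?case .
qed simp

text \<open>The sum of the two recursions is \<open>t ^ (2 * m) + s ^ (2 * m)\<close> plus the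
  nonnegative term of the previous lemma. Parity is essential: in even degree the divided difference
  vanishes for \<open>s = - t\<close>.\<close>

lemma power_dd_odd_ge:
  fixes t s :: real
  assumes "odd k"
  shows "max \<bar>t\<bar> \<bar>s\<bar> ^ (k - 1) \<le> 2 * power_dd k t s"
proof -
  obtain m where k: "k = Suc (2 * m)"
    using assms by (auto elim: oddE)
  have "2 * power_dd k t s = t ^ (2 * m) + s ^ (2 * m) + (t + s) * power_dd (2 * m) t s"
    using power_dd_Suc'[of "2 * m" t s] unfolding k by (simp add: algebra_simps)
  also have "\<dots> \<ge> \<bar>t\<bar> ^ (2 * m) + \<bar>s\<bar> ^ (2 * m)"
    using sum_times_power_dd_even_nonneg[of t s m] by (simp add: power_even_abs)
  moreover have "max \<bar>t\<bar> \<bar>s\<bar> ^ (2 * m) \<le> \<bar>t\<bar> ^ (2 * m) + \<bar>s\<bar> ^ (2 * m)"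
    by (auto simp: max_def)
  ultimately show ?thesis
    by (simp add: k)
qed

text \<open>Given by coefficients instead of a quotient, so that it is continuous across the
  diagonal, where it becomes the derivative.\<close>

definition poly_dd :: "'a::comm_ring_1 poly \<Rightarrow> 'a \<Rightarrow> 'a \<Rightarrow> 'a" where
  "poly_dd p t s = (\<Sum>i\<le>degree p. coeff p i * power_dd i t s)"

lemma poly_dd_degree_le:
  assumes "degree p \<le> n"
  shows "poly_dd p t s = (\<Sum>i\<le>n. coeff p i * power_dd i t s)"
  unfolding poly_dd_def using assms
  by (intro sum.mono_neutral_left) (auto simp: coeff_eq_0)

lemma diff_poly_eq_dd: "poly p t - poly p s = (t - s) * poly_dd p t s"
proof -
  have "poly p t - poly p s = (\<Sum>i\<le>degree p. coeff p i * (t ^ i - s ^ i))"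
    by (simp add: poly_altdef right_diff_distrib sum_subtractf)
  then show ?thesis
    by (simp add: diff_power_eq_dd poly_dd_def sum_distrib_left mult.left_commute)
qed

lemma poly_dd_diag: "poly_dd p t t = poly (pderiv p) t" for p :: "'a::idom poly"
proof -
  have "poly (pderiv p) t = poly (pderiv (\<Sum>i\<le>degree p. monom (coeff p i) i)) t"
    by (simp add: poly_as_sum_of_monoms)
  also have "\<dots> = (\<Sum>i\<le>degree p. coeff p i * (of_nat i * t ^ (i - 1)))"
    by (simp add: higher_pderiv_sum[of 1, simplified] pderiv_monom poly_sum poly_monom algebra_simps)
  finally show ?thesis
    by (simp add: poly_dd_def power_dd_diag)
qed

lemma continuous_on_poly_dd [continuous_intros]:
  fixes f g :: "'a::topological_space \<Rightarrow> real"
  assumes "continuous_on A f" "continuous_on A g"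
  shows "continuous_on A (\<lambda>x. poly_dd p (f x) (g x))"
  unfolding poly_dd_def by (intro continuous_intros assms)

section \<open>Divided differences of a knot dominate those of monomials\<close>

text \<open>In odd degree \<open>n\<close> the leading part \<open>power_dd n\<close> is bounded below by half the
  \<open>(n-1)\<close>-st power of the radius, and the lower order terms are negligible at infinity.\<close>
lemma power_dd_le_poly_dd_at_infinity:
  fixes p :: "real poly"
  assumes n: "odd n" and deg: "degree p \<le> n" and lead: "coeff p n \<noteq> 0"
  shows "\<exists>C R. 0 \<le> C \<and> (\<forall>t s k. R \<le> max \<bar>t\<bar> \<bar>s\<bar> \<longrightarrow> k \<le> n \<longrightarrow> \<bar>power_dd k t s\<bar> \<le> C * \<bar>poly_dd p t s\<bar>)"
proof -
  define K where "K = (\<Sum>i<n. \<bar>coeff p i\<bar> * n)"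
  define c where "c = \<bar>coeff p n\<bar>"
  have c: "c > 0"
    using lead by (simp add: c_def)
  \<comment> \<open>Radius at least 1 makes powers increase with the exponent; radius at least
    \<open>4 * K / c\<close> keeps the lower terms within half of the bound
    \<open>c * r ^ (n - 1) / 2\<close> for the leading one.\<close>
  define R where "R = max 1 (4 * K / c)"
  have "\<bar>power_dd k t s\<bar> \<le> (4 * n / c) * \<bar>poly_dd p t s\<bar>"
    if R: "R \<le> max \<bar>t\<bar> \<bar>s\<bar>" and k: "k \<le> n" for t s k
  proof -
    define r where "r = max \<bar>t\<bar> \<bar>s\<bar>"
    have r: "1 \<le> r" "4 * K / c \<le> r" "\<bar>t\<bar> \<le> r" "\<bar>s\<bar> \<le> r"
      using R by (auto simp: R_def r_def)
    have up: "\<bar>power_dd i t s\<bar> \<le> n * r ^ j" if "i \<le> n" "i - 1 \<le> j" for i j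
    proof -
      have "\<bar>power_dd i t s\<bar> \<le> i * r ^ (i - 1)"
        by (rule abs_power_dd_le) (use r in auto)
      also have "\<dots> \<le> n * r ^ j"
        using that r by (intro mult_mono power_increasing) auto
      finally show ?thesis .
    qed
    have lower: "\<bar>\<Sum>i<n. coeff p i * power_dd i t s\<bar> \<le> c * r ^ (n - 1) / 4"
    \<comment> \<open>For \<open>n = 1\<close> only the constant term is left and
      \<open>power_dd 0\<close> is 0; otherwise the exponent \<open>n - 2\<close> is a true
      subtraction.\<close>
    proof (cases "n = 1")
      case True
      then show ?thesis using c by simp
    next
      case False
      then obtain m where m: "n = Suc (Suc m)"
        using odd_pos[OF n] by (metis One_nat_def gr0_implies_Suc neq0_conv)
      have "\<bar>\<Sum>i<n. coeff p i * power_dd i t s\<bar> \<le> (\<Sum>i<n. \<bar>coeff p i\<bar> * (n * r ^ (n - 2)))"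
        by (rule order_trans[OF sum_abs sum_mono]) (auto simp: abs_mult intro!: mult_left_mono up)
      also have "\<dots> = K * r ^ (n - 2)"
        by (simp add: K_def sum_distrib_right mult.assoc)
      also have "\<dots> \<le> (c * r / 4) * r ^ (n - 2)"
        using r c by (intro mult_right_mono) (auto simp: field_simps)
      also have "\<dots> = c * r ^ (n - 1) / 4"
        by (simp add: m)
      finally show ?thesis .
    qed
    have "poly_dd p t s = (\<Sum>i<n. coeff p i * power_dd i t s) + coeff p n * power_dd n t s"
      using poly_dd_degree_le[OF deg] by (simp add: lessThan_Suc_atMost[symmetric])
    moreover have "c * r ^ (n - 1) / 2 \<le> \<bar>coeff p n * power_dd n t s\<bar>"
    proof -
      have "r ^ (n - 1) \<le> 2 * \<bar>power_dd n t s\<bar>"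
        using power_dd_odd_ge[OF n, of t s] by (simp add: r_def)
      from mult_left_mono[OF this, of c] show ?thesis
        using c by (simp add: abs_mult c_def)
    qed
    ultimately have "c * r ^ (n - 1) / 4 \<le> \<bar>poly_dd p t s\<bar>"
      using lower by linarith
    then have "r ^ (n - 1) \<le> 4 / c * \<bar>poly_dd p t s\<bar>"
      using c by (simp add: field_simps)
    from mult_left_mono[OF this, of "real n"] show ?thesis
      using up[OF k diff_le_mono[OF k]] by (simp add: mult_ac)
  qed
  moreover have "0 \<le> 4 * n / c"
    using c by simp
  ultimately show ?thesis
    by blast
qed

text \<open>The l1 norm of the divided difference of the curve; multiplied by the parameter distance
  it is the l1 length of a chord.\<close>

definition knot_dd :: "real poly \<Rightarrow> real poly \<Rightarrow> real poly \<Rightarrow> real \<Rightarrow> real \<Rightarrow> real" where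
  "knot_dd f g h t s = \<bar>poly_dd f t s\<bar> + \<bar>poly_dd g t s\<bar> + \<bar>poly_dd h t s\<bar>"

text \<open>A zero off the diagonal is a double point, and a zero on the diagonal is a point of
  vanishing velocity; an embedding has neither.\<close>

lemma knot_dd_pos:
  assumes "poly_knot f g h"
  shows "0 < knot_dd f g h t s"
proof -
  have "\<not> (poly_dd f t s = 0 \<and> poly_dd g t s = 0 \<and> poly_dd h t s = 0)"
  proof
    assume z: "poly_dd f t s = 0 \<and> poly_dd g t s = 0 \<and> poly_dd h t s = 0"
    show False
    proof (cases "t = s")
      case True
      then show False
        using z assms by (auto simp: poly_dd_diag poly_knot_def)
    next
      case False
      have "poly p t = poly p s" if "poly_dd p t s = 0" for p
        using diff_poly_eq_dd[of p t s] that by simp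
      then have "polymap f g h t = polymap f g h s"
        using z by (simp add: polymap_def)
      then show False
        using assms False by (auto simp: poly_knot_def dest: injD)
    qed
  qed
  then show ?thesis
    unfolding knot_dd_def by linarith
qed

text \<open>One of the degrees \<open>d\<close>, \<open>d - 1\<close> is odd. If it is \<open>d - 1\<close>, then the component \<open>g\<close> controls
  \<open>power_dd k\<close> for \<open>k < d\<close>, and \<open>power_dd d\<close> is read off from \<open>h\<close>.\<close>
lemma power_dd_le_knot_dd_at_infinity:
  assumes d: "d \<ge> 2" and Q: "in_Q d f g h"
  shows "\<exists>C R. 0 \<le> C \<and> (\<forall>t s k. R \<le> max \<bar>t\<bar> \<bar>s\<bar> \<longrightarrow> k \<le> d \<longrightarrow> \<bar>power_dd k t s\<bar> \<le> C * knot_dd f g h t s)"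
proof (cases "odd d")
  case True
  have "degree h \<le> d" "coeff h d \<noteq> 0"
    using Q by (auto simp: in_Q_def in_A_def)
  from power_dd_le_poly_dd_at_infinity[OF True this] obtain C R where C: "0 \<le> C"
    "\<And>t s k. R \<le> max \<bar>t\<bar> \<bar>s\<bar> \<Longrightarrow> k \<le> d \<Longrightarrow> \<bar>power_dd k t s\<bar> \<le> C * \<bar>poly_dd h t s\<bar>"
    by blast
  have "C * \<bar>poly_dd h t s\<bar> \<le> C * knot_dd f g h t s" for t s
    using C(1) by (intro mult_left_mono) (auto simp: knot_dd_def)
  then show ?thesis
    using C order_trans by blast
next
  case False
  then have "odd (d - 1)"
    using d by simp
  moreover have "degree g \<le> d - 1" "coeff g (d - 1) \<noteq> 0"
    using Q by (auto simp: in_Q_def in_A_def)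
  ultimately obtain C R where C: "0 \<le> C"
    "\<And>t s k. R \<le> max \<bar>t\<bar> \<bar>s\<bar> \<Longrightarrow> k \<le> d - 1 \<Longrightarrow> \<bar>power_dd k t s\<bar> \<le> C * \<bar>poly_dd g t s\<bar>"
    using power_dd_le_poly_dd_at_infinity[of "d - 1" g] by blast
  define c where "c = \<bar>coeff h d\<bar>"
  have c: "c > 0"
    using Q by (simp add: c_def in_Q_def)
  define S where "S = (\<Sum>i<d. \<bar>coeff h i\<bar>)"
  have S: "0 \<le> S"
    by (simp add: S_def sum_nonneg)
  \<comment> \<open>\<open>C\<close> serves \<open>k < d\<close>; \<open>(1 + S * C) / c\<close>
    results from solving the expansion of \<open>poly_dd h\<close> for its leading term.\<close>
  define D where "D = C + (1 + S * C) / c"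
  have D: "C \<le> D" "(1 + S * C) / c \<le> D"
    using C(1) S c by (auto simp: D_def)
  have "\<bar>power_dd k t s\<bar> \<le> D * knot_dd f g h t s" if R: "R \<le> max \<bar>t\<bar> \<bar>s\<bar>" and k: "k \<le> d" for t s k
  proof -
    define N where "N = knot_dd f g h t s"
    have N: "0 \<le> N" "\<bar>poly_dd g t s\<bar> \<le> N" "\<bar>poly_dd h t s\<bar> \<le> N"
      by (auto simp: N_def knot_dd_def)
    have low: "\<bar>power_dd i t s\<bar> \<le> C * N" if "i < d" for i
    proof -
      have "\<bar>power_dd i t s\<bar> \<le> C * \<bar>poly_dd g t s\<bar>"
        using C(2)[OF R, of i] that by simp
      also have "\<dots> \<le> C * N"
        using C(1) N by (intro mult_left_mono)
      finally show ?thesis .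
    qed
    show ?thesis
    proof (cases "k = d")
      case True
      have "degree h \<le> d"
        using Q by (simp add: in_Q_def in_A_def)
      then have "coeff h d * power_dd d t s = poly_dd h t s - (\<Sum>i<d. coeff h i * power_dd i t s)"
        by (simp add: poly_dd_degree_le lessThan_Suc_atMost[symmetric])
      moreover have "\<bar>\<Sum>i<d. coeff h i * power_dd i t s\<bar> \<le> S * (C * N)"
        unfolding S_def sum_distrib_right
        by (rule order_trans[OF sum_abs sum_mono]) (auto simp: abs_mult intro!: mult_left_mono low)
      ultimately have "\<bar>coeff h d * power_dd d t s\<bar> \<le> N + S * (C * N)"
        using N(3) by linarith
      then have "\<bar>power_dd d t s\<bar> \<le> (1 + S * C) / c * N"
        using c by (simp add: abs_mult field_simps flip: c_def)
      also have "\<dots> \<le> D * N"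
        using D N by (intro mult_right_mono)
      finally show ?thesis
        by (simp add: True N_def)
    next
      case False
      then have "\<bar>power_dd k t s\<bar> \<le> C * N"
        using low k by simp
      also have "\<dots> \<le> D * N"
        using D N by (intro mult_right_mono)
      finally show ?thesis
        by (simp add: N_def)
    qed
  qed
  moreover have "0 \<le> D"
    using C(1) D by linarith
  ultimately show ?thesis
    by blast
qed

text \<open>Far out the bound at infinity applies. On the remaining compact square
  \<open>knot_dd\<close> has a positive minimum, since it is continuous and positive.\<close>

lemma power_dd_le_knot_dd:
  assumes d: "d \<ge> 2" and Q: "in_Q d f g h"
  shows "\<exists>C. 0 < C \<and> (\<forall>t s k. k \<le> d \<longrightarrow> \<bar>power_dd k t s\<bar> \<le> C * knot_dd f g h t s)"
proof -
  have pos: "0 < knot_dd f g h t s" for t s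
    using Q by (intro knot_dd_pos) (simp add: in_Q_def)
  obtain C R where C: "0 \<le> C"
    "\<And>t s k. R \<le> max \<bar>t\<bar> \<bar>s\<bar> \<Longrightarrow> k \<le> d \<Longrightarrow> \<bar>power_dd k t s\<bar> \<le> C * knot_dd f g h t s"
    using power_dd_le_knot_dd_at_infinity[OF assms] by blast
  \<comment> \<open>The absolute value keeps the square nonempty even for negative
    \<open>R\<close>.\<close>
  define X where "X = {-\<bar>R\<bar>..\<bar>R\<bar>} \<times> {-\<bar>R\<bar>..\<bar>R\<bar>}"
  have "compact X" "X \<noteq> {}"
    by (auto simp: X_def intro: compact_Times)
  moreover have "continuous_on X (\<lambda>z. knot_dd f g h (fst z) (snd z))"
    unfolding knot_dd_def by (intro continuous_intros)
  ultimately obtain z0 where z0: "\<And>z. z \<in> X \<Longrightarrow>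
      knot_dd f g h (fst z0) (snd z0) \<le> knot_dd f g h (fst z) (snd z)"
    using continuous_attains_inf[of X "\<lambda>z. knot_dd f g h (fst z) (snd z)"] by blast
  define m where "m = knot_dd f g h (fst z0) (snd z0)"
  have m: "m > 0"
    by (simp add: m_def pos)
  \<comment> \<open>A common bound on the square for all \<open>power_dd k\<close> with
    \<open>k \<le> d\<close>; \<open>max 1\<close> allows raising the exponent to
    \<open>d\<close>.\<close>
  define B where "B = d * max 1 \<bar>R\<bar> ^ d"
  define D where "D = C + B / m"
  have B: "0 < B"
    using d by (simp add: B_def)
  then have D: "C \<le> D" "B / m \<le> D" "0 < D"
    using m C(1) by (auto simp: D_def add_nonneg_pos)
  have "\<bar>power_dd k t s\<bar> \<le> D * knot_dd f g h t s" if k: "k \<le> d" for t s k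
  proof (cases "R \<le> max \<bar>t\<bar> \<bar>s\<bar>")
    case True
    from C(2)[OF True k] have "\<bar>power_dd k t s\<bar> \<le> C * knot_dd f g h t s" .
    also have "\<dots> \<le> D * knot_dd f g h t s"
      using D pos[of t s] by (intro mult_right_mono) auto
    finally show ?thesis .
  next
    case False
    then have "(t, s) \<in> X"
      by (auto simp: X_def)
    then have mle: "m \<le> knot_dd f g h t s"
      using z0 by (force simp: m_def)
    have "\<bar>power_dd k t s\<bar> \<le> k * max 1 \<bar>R\<bar> ^ (k - 1)"
      using False by (intro abs_power_dd_le) auto
    also have "\<dots> \<le> B"
      unfolding B_def using k by (intro mult_mono power_increasing) auto
    also have "\<dots> = (B / m) * m"
      using m by simp
    also have "\<dots> \<le> D * knot_dd f g h t s"
      using mle D m by (intro mult_mono) auto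
    finally show ?thesis .
  qed
  then show ?thesis
    using D by blast
qed

section \<open>Small perturbations of a knot\<close>

lemma dist_polymap:
  "\<bar>t - s\<bar> * knot_dd f g h t s \<le> 3 * dist (polymap f g h t) (polymap f g h s)"
proof -
  have "\<bar>t - s\<bar> * knot_dd f g h t s
      = \<bar>poly f t - poly f s\<bar> + \<bar>poly g t - poly g s\<bar> + \<bar>poly h t - poly h s\<bar>"
    by (simp add: knot_dd_def diff_poly_eq_dd abs_mult distrib_left)
  then show ?thesis
    using abs_le_norm_triple[where x = "poly f t - poly f s" and y = "poly g t - poly g s"
        and z = "poly h t - poly h s"]
    by (simp add: dist_norm polymap_def)
qed

text \<open>The divided difference of \<open>p\<close> is a combination of \<open>d + 1\<close>
  terms \<open>power_dd i\<close>, each at most \<open>C * knot_dd\<close>, and the parameter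
  distance times \<open>knot_dd\<close> is controlled by the chord. So small coefficients make
  \<open>p\<close> a function on the curve with small Lipschitz constant.\<close>

lemma poly_diff_lipschitz_knot:
  fixes p :: "real poly"
  assumes C: "0 \<le> C" "\<And>k. k \<le> d \<Longrightarrow> \<bar>power_dd k t s\<bar> \<le> C * knot_dd f g h t s"
    and deg: "degree p \<le> d" and e: "\<And>i. i \<le> d \<Longrightarrow> \<bar>coeff p i\<bar> \<le> e"
  shows "\<bar>poly p t - poly p s\<bar> \<le> 3 * real (d + 1) * e * C * dist (polymap f g h t) (polymap f g h s)"
proof -
  have e0: "0 \<le> e"
    using e[of 0] by simp
  have "\<bar>poly_dd p t s\<bar> \<le> (\<Sum>i\<le>d. e * (C * knot_dd f g h t s))"
    unfolding poly_dd_degree_le[OF deg]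
    by (rule order_trans[OF sum_abs sum_mono]) (auto simp: abs_mult e0 intro!: mult_mono e C)
  then have "\<bar>t - s\<bar> * \<bar>poly_dd p t s\<bar> \<le> \<bar>t - s\<bar> * (\<Sum>i\<le>d. e * (C * knot_dd f g h t s))"
    by (rule mult_left_mono) simp
  also have "\<dots> = real (d + 1) * e * C * (\<bar>t - s\<bar> * knot_dd f g h t s)"
    by (simp add: algebra_simps)
  also have "\<dots> \<le> real (d + 1) * e * C * (3 * dist (polymap f g h t) (polymap f g h s))"
    using e0 C(1) by (intro mult_left_mono dist_polymap) auto
  finally show ?thesis
    unfolding diff_poly_eq_dd abs_mult by (simp only: mult_ac)
qed

lemma top_equivalent_near:
  assumes d: "d \<ge> 2" and Q: "in_Q d f g h"
  shows "\<exists>e>0. \<forall>f' g' h'. in_A d f' g' h' \<longrightarrow>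
    (\<forall>i\<le>d. \<bar>coeff f' i - coeff f i\<bar> \<le> e \<and> \<bar>coeff g' i - coeff g i\<bar> \<le> e \<and> \<bar>coeff h' i - coeff h i\<bar> \<le> e) \<longrightarrow>
    top_equivalent (polymap f g h) (polymap f' g' h')"
proof -
  obtain C where C: "0 < C" "\<And>t s k. k \<le> d \<Longrightarrow> \<bar>power_dd k t s\<bar> \<le> C * knot_dd f g h t s"
    using power_dd_le_knot_dd[OF assms] by blast
  \<comment> \<open>Chosen so that each component of the difference is 1/6-Lipschitz; three
    components then give the contraction constant 1/2.\<close>
  define e where "e = 1 / (18 * real (d + 1) * C)"
  have "e > 0"
    using C by (simp add: e_def)
  have eC: "3 * real (d + 1) * e * C = 1/6"
    using C(1) by (simp add: e_def)
  define \<phi> where "\<phi> = polymap f g h"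
  have ext: "\<exists>u. (\<forall>t. u (\<phi> t) = poly q t - poly p t) \<and> (\<forall>x y. \<bar>u x - u y\<bar> \<le> 1/6 * dist x y)"
    if "degree p \<le> d" "degree q \<le> d" "\<forall>i\<le>d. \<bar>coeff q i - coeff p i\<bar> \<le> e"
    for p q :: "real poly"
  proof (rule lipschitz_extension_real)
    fix t s
    have "\<bar>poly (q - p) t - poly (q - p) s\<bar> \<le> 3 * real (d + 1) * e * C * dist (\<phi> t) (\<phi> s)"
      unfolding \<phi>_def using that C by (intro poly_diff_lipschitz_knot) (auto intro: degree_diff_le)
    then show "\<bar>poly q t - poly p t - (poly q s - poly p s)\<bar> \<le> 1/6 * dist (\<phi> t) (\<phi> s)"
      by (simp only: eC poly_diff)
  qed simp
  have "top_equivalent \<phi> (polymap f' g' h')"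
    if A: "in_A d f' g' h'" and near: "\<forall>i\<le>d. \<bar>coeff f' i - coeff f i\<bar> \<le> e \<and>
      \<bar>coeff g' i - coeff g i\<bar> \<le> e \<and> \<bar>coeff h' i - coeff h i\<bar> \<le> e" for f' g' h'
  proof -
    have deg: "degree f \<le> d" "degree g \<le> d" "degree h \<le> d"
        "degree f' \<le> d" "degree g' \<le> d" "degree h' \<le> d"
      using A Q by (auto simp: in_Q_def in_A_def)
    obtain u1 where u1: "\<And>t. u1 (\<phi> t) = poly f' t - poly f t" "\<And>x y. \<bar>u1 x - u1 y\<bar> \<le> 1/6 * dist x y"
      using ext[OF deg(1,4)] near by blast
    obtain u2 where u2: "\<And>t. u2 (\<phi> t) = poly g' t - poly g t" "\<And>x y. \<bar>u2 x - u2 y\<bar> \<le> 1/6 * dist x y"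
      using ext[OF deg(2,5)] near by blast
    obtain u3 where u3: "\<And>t. u3 (\<phi> t) = poly h' t - poly h t" "\<And>x y. \<bar>u3 x - u3 y\<bar> \<le> 1/6 * dist x y"
      using ext[OF deg(3,6)] near by blast
    define u where "u x = (u1 x, u2 x, u3 x)" for x
    show ?thesis
    proof (rule top_equivalent_lipschitz_perturbation)
      fix x y
      have "dist (u x) (u y) \<le> \<bar>u1 x - u1 y\<bar> + \<bar>u2 x - u2 y\<bar> + \<bar>u3 x - u3 y\<bar>"
        using norm_triple_le by (simp add: u_def dist_norm)
      then show "dist (u x) (u y) \<le> 1/2 * dist x y"
        using u1(2)[of x y] u2(2)[of x y] u3(2)[of x y] by linarith
    next
      fix t
      show "polymap f' g' h' t = \<phi> t + u (\<phi> t)"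
        unfolding u_def u1 u2 u3 by (simp add: \<phi>_def polymap_def)
    qed auto
  qed
  then show ?thesis
    using \<open>e > 0\<close> unfolding \<phi>_def by blast
qed

section \<open>Local constancy along a path\<close>

theorem mainTheorem5:
  fixes d :: nat and f1 g1 h1 f2 g2 h2 :: "real poly"
  assumes "d \<ge> 2"
    and "same_path_component_Q d (f1, g1, h1) (f2, g2, h2)"
  shows "top_equivalent (polymap f1 g1 h1) (polymap f2 g2 h2)"
proof -
  from assms(2) obtain F G H :: "real \<Rightarrow> real poly" where
    Q: "\<And>s. s \<in> {0..1} \<Longrightarrow> in_Q d (F s) (G s) (H s)"
    and cont: "\<And>i. continuous_on {0..1} (\<lambda>s. coeff (F s) i)"
      "\<And>i. continuous_on {0..1} (\<lambda>s. coeff (G s) i)"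
      "\<And>i. continuous_on {0..1} (\<lambda>s. coeff (H s) i)"
    and ends: "F 0 = f1" "G 0 = g1" "H 0 = h1" "F 1 = f2" "G 1 = g2" "H 1 = h2"
    unfolding same_path_component_Q_def prod.inject by blast
  define K where "K s = polymap (F s) (G s) (H s)" for s
  have "top_equivalent (K 0) (K 1)"
  \<comment> \<open>An equivalence relation on a connected space whose classes contain a
    neighbourhood of each of their points has a single class.\<close>
  proof (rule connected_equivalence_relation[of "{0..1::real}"])
    fix a :: real
    assume a: "a \<in> {0..1}"
    obtain e where e: "e > 0" "\<And>f' g' h'. in_A d f' g' h' \<Longrightarrow>
      (\<forall>i\<le>d. \<bar>coeff f' i - coeff (F a) i\<bar> \<le> e \<and> \<bar>coeff g' i - coeff (G a) i\<bar> \<le> e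
         \<and> \<bar>coeff h' i - coeff (H a) i\<bar> \<le> e) \<Longrightarrow> top_equivalent (K a) (polymap f' g' h')"
      using top_equivalent_near[OF assms(1) Q[OF a]] unfolding K_def by blast
    \<comment> \<open>One continuous function dominating all coefficient deviations up to index
      \<open>d\<close>, so that a single sublevel set is the required open neighbourhood.\<close>
    define dev where "dev s = (\<Sum>i\<le>d. \<bar>coeff (F s) i - coeff (F a) i\<bar>
      + \<bar>coeff (G s) i - coeff (G a) i\<bar> + \<bar>coeff (H s) i - coeff (H a) i\<bar>)" for s
    define T where "T = {s \<in> {0..1}. dev s < e}"
    have "continuous_on {0..1} dev"
      unfolding dev_def by (intro continuous_intros cont)
    then have "openin (top_of_set {0..1}) T"
      unfolding T_def using continuous_openin_preimage_gen[of "{0..1}" dev "{..<e}"]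
      by (simp add: vimage_def Int_def)
    moreover have "a \<in> T"
      using a e by (simp add: T_def dev_def)
    moreover have "top_equivalent (K a) (K s)" if s: "s \<in> T" for s
      unfolding K_def[of s]
    proof (rule e)
      show "in_A d (F s) (G s) (H s)"
        using s Q by (auto simp: T_def in_Q_def)
      have "\<bar>coeff (F s) i - coeff (F a) i\<bar> + \<bar>coeff (G s) i - coeff (G a) i\<bar>
          + \<bar>coeff (H s) i - coeff (H a) i\<bar> \<le> dev s" if "i \<le> d" for i
        unfolding dev_def
        by (rule member_le_sum[of i "{..d}" "\<lambda>i. \<bar>coeff (F s) i - coeff (F a) i\<bar>
          + \<bar>coeff (G s) i - coeff (G a) i\<bar> + \<bar>coeff (H s) i - coeff (H a) i\<bar>"])
          (use that in auto)
      then show "\<forall>i\<le>d. \<bar>coeff (F s) i - coeff (F a) i\<bar> \<le> e \<and> \<bar>coeff (G s) i - coeff (G a) i\<bar> \<le> e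
         \<and> \<bar>coeff (H s) i - coeff (H a) i\<bar> \<le> e"
        using s unfolding T_def by (smt (verit) mem_Collect_eq)
    qed
    ultimately show "\<exists>T. openin (top_of_set {0..1}) T \<and> a \<in> T \<and> (\<forall>x\<in>T. top_equivalent (K a) (K x))"
      by blast
  next
    show "top_equivalent (K y) (K x)" if "top_equivalent (K x) (K y)" for x y
      using that ambient_isotopic_sym knot_ext_in_S3 unfolding top_equivalent_def by blast
    show "top_equivalent (K x) (K z)" if "top_equivalent (K x) (K y)" "top_equivalent (K y) (K z)" for x y z
      using that ambient_isotopic_trans unfolding top_equivalent_def by blast
  qed auto
  then show ?thesis
    by (simp add: K_def ends)
qed

end
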